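(* Consider the scale of Lebesgue sequence spaces $E_a:=\ell^p(\mathbb N_1,\mathbb C)$, $p=1/a$, $\|\cdot\|_a:=\|\cdot\|_{\ell^p}$, $a\in\mathcal I:=[0,1]$ (with $1/0:=\infty$). Then there does not exist any family $(S_\theta)_{\theta\in[1,\infty)}$ of linear operators $S_\theta:E_0\to E_\infty:=\bigcap_{a\in[0,1]}E_a$ satisfying, for all $\theta\ge1$ and all $a,b\in[0,1]$ with $a\le b$, $$\|S_\theta u\|_b\le A_{ab}\theta^{b-a}\|u\|_a\quad\forall u\in E_a,\qquad \|u-S_\theta u\|_a\le B_{ab}\theta^{-(b-a)}\|u\|_b\quad\forall u\in E_b,$$ with constants $A_{ab},B_{ab}$ bounded for $a,b\in[0,1]$. More is true: fix any two real numbers $a,b\in[0,1]$ with $a<b$, and let $p:=1/a$, $q:=1/b$. Let $(S_\theta)_{\theta\ge1}$ be a family of linear operators $S_\theta:\ell^p\to\ell^q$ such that $$\|S_\theta x\|_{\ell^q}\le A_{ab}\,\theta^{b-a}\|x\|_{\ell^p}\qquad\forall x\in\ell^p,\ \forall\theta\ge1,$$ for some constant $A_{ab}>0$ independent of $x,\theta$. Then there does not exist any constant $B_{ab}>0$, independent of $x,\theta$, such that $$\|x-S_\theta x\|_{\ell^p}\le B_{ab}\,\theta^{-(b-a)}\|x\|_{\ell^q}\qquad\forall x\in\ell^q,\ \forall\theta\ge1.$$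
   Context: $\mathbb N_1:=\{1,2,\dots\}$. For $p\in[1,\infty]$, $\ell^p=\ell^p(\mathbb N_1,\mathbb C)$ is the space of complex sequences $x=(x_1,x_2,\dots)$ with finite norm $\|x\|_{\ell^p}=(\sum_{k\ge1}|x_k|^p)^{1/p}$ for $p<\infty$, $\|x\|_{\ell^\infty}=\sup_k|x_k|$. One has $\ell^q\subseteq\ell^p$ and $\|x\|_{\ell^p}\le\|x\|_{\ell^q}$ for $q\le p$. Convention: $1/0=\infty$. *)

theory Defs
  imports "HOL-Analysis.Analysis"
begin

text \<open>
  A sequence \<open>(x\<^sub>1, x\<^sub>2, \<dots>)\<close> is a function \<open>x :: nat \<Rightarrow> complex\<close> in which \<open>x k\<close> is the entry
  \<open>x\<^sub>k\<^sub>+\<^sub>1\<close>. Exponents are extended reals, only \<open>1 \<le> p \<le> \<infinity>\<close> being meaningful, so that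
  \<open>p = 1 / ereal a\<close> includes the convention \<open>1 / 0 = \<infinity>\<close>.
\<close>

definition lp_space :: "ereal \<Rightarrow> (nat \<Rightarrow> complex) set" where
  "lp_space p =
     (if p = \<infinity> then {x. bounded (range x)}
      else {x. summable (\<lambda>k. norm (x k) powr real_of_ereal p)})"

text \<open>The norm is real-valued, hence meaningful only on \<open>lp_space p\<close>, where it is finite.\<close>

definition lp_norm :: "ereal \<Rightarrow> (nat \<Rightarrow> complex) \<Rightarrow> real" where
  "lp_norm p x =
     (if p = \<infinity> then (SUP k. norm (x k))
      else (\<Sum>k. norm (x k) powr real_of_ereal p) powr (1 / real_of_ereal p))"

definition scale_space :: "real \<Rightarrow> (nat \<Rightarrow> complex) set" where
  "scale_space a = lp_space (1 / ereal a)"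

definition scale_norm :: "real \<Rightarrow> (nat \<Rightarrow> complex) \<Rightarrow> real" where
  "scale_norm a x = lp_norm (1 / ereal a) x"

definition scale_space_inf :: "(nat \<Rightarrow> complex) set" where
  "scale_space_inf = (\<Inter>a\<in>{0..1}. scale_space a)"

definition linear_operator ::
    "(nat \<Rightarrow> complex) set \<Rightarrow> (nat \<Rightarrow> complex) set \<Rightarrow> ((nat \<Rightarrow> complex) \<Rightarrow> (nat \<Rightarrow> complex)) \<Rightarrow> bool" where
  "linear_operator X Y T \<longleftrightarrow>
     T \<in> X \<rightarrow> Y \<and>
     (\<forall>x\<in>X. \<forall>y\<in>X. T (\<lambda>k. x k + y k) = (\<lambda>k. T x k + T y k)) \<and>
     (\<forall>c. \<forall>x\<in>X. T (\<lambda>k. c * x k) = (\<lambda>k. c * T x k))"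

lemma scale_space_0: "scale_space 0 = {x. bounded (range x)}"
  by (simp add: scale_space_def lp_space_def flip: zero_ereal_def)

lemma scale_norm_0: "scale_norm 0 x = (SUP k. norm (x k))"
  by (simp add: scale_norm_def lp_norm_def flip: zero_ereal_def)

lemma scale_space_pos:
  "a > 0 \<Longrightarrow> scale_space a = {x. summable (\<lambda>k. norm (x k) powr (1 / a))}"
  by (simp add: scale_space_def lp_space_def one_ereal_def)

lemma scale_norm_pos:
  "a > 0 \<Longrightarrow> scale_norm a x = (\<Sum>k. norm (x k) powr (1 / a)) powr a"
  by (simp add: scale_norm_def lp_norm_def one_ereal_def)

end

theory Submission
  imports Defs "HOL-Real_Asymp.Real_Asymp"
begin

text \<open>
  Only one value of \<open>\<theta>\<close> matters: choose it so large that \<open>T = S \<theta>\<close> satisfies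
  \<open>\<parallel>x - T x\<parallel>\<^sub>a \<le> \<parallel>x\<parallel>\<^sub>b / 2\<close>. Tested on unit vectors, this bounds the diagonal entries of \<open>T\<close>
  below by \<open>1/2\<close>. For suitable signs \<open>\<epsilon>\<close> supported on the first \<open>N\<close> entries, the
  quadratic form of \<open>T\<close> at \<open>\<epsilon>\<close> is at least the trace of the \<open>N \<times> N\<close> block, hence at least
  \<open>N/2\<close>; by Hoelder it is at most \<open>N\<^sup>1\<^sup>-\<^sup>b \<parallel>T \<epsilon>\<parallel>\<^sub>b\<close>, which is at most \<open>C N\<^sup>1\<^sup>-\<^sup>b N\<^sup>a\<close>.
  As \<open>a < b\<close>, this fails for large \<open>N\<close>.
\<close>

section \<open>Signs for which a quadratic form dominates the trace\<close>

text \<open>Over independent uniform signs the off-diagonal terms average to zero, so the quadratic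
  form has mean equal to the trace and some choice reaches it. The induction makes this choice
  greedily, one sign at a time.\<close>

lemma ex_signs_trace_le:
  fixes T :: "nat \<Rightarrow> nat \<Rightarrow> real"
  shows "\<exists>\<epsilon>::nat \<Rightarrow> real. (\<forall>i. \<bar>\<epsilon> i\<bar> = 1) \<and>
    (\<Sum>i<N. T i i) \<le> (\<Sum>i<N. \<Sum>j<N. \<epsilon> i * \<epsilon> j * T i j)"
proof (induction N)
  case 0
  show ?case by (rule exI[of _ "\<lambda>_. 1"]) simp
next
  case (Suc N)
  then obtain \<epsilon> :: "nat \<Rightarrow> real" where e: "\<And>i. \<bar>\<epsilon> i\<bar> = 1"
    and le: "(\<Sum>i<N. T i i) \<le> (\<Sum>i<N. \<Sum>j<N. \<epsilon> i * \<epsilon> j * T i j)"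
    by blast
  \<comment> \<open>\<open>r\<close> collects the cross terms from the new row and column. They
    enter multiplied by the new sign \<open>s\<close>, which is chosen to make \<open>s * r\<close>
    nonnegative.\<close>
  define r where "r = (\<Sum>j<N. \<epsilon> j * (T N j + T j N))"
  define s :: real where "s = (if r \<ge> 0 then 1 else -1)"
  define \<delta> where "\<delta> = \<epsilon>(N := s)"
  have s: "\<bar>s\<bar> = 1" "s * s = 1" "s * r \<ge> 0"
    by (auto simp: s_def)
  have 1: "(\<Sum>i<N. \<Sum>j<N. \<delta> i * \<delta> j * T i j) = (\<Sum>i<N. \<Sum>j<N. \<epsilon> i * \<epsilon> j * T i j)"
    by (intro sum.cong refl) (auto simp: \<delta>_def)
  have 2: "(\<Sum>j<N. \<delta> N * \<delta> j * T N j) + (\<Sum>i<N. \<delta> i * \<delta> N * T i N) = s * r"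
    unfolding r_def sum_distrib_left sum.distrib[symmetric]
    by (intro sum.cong refl) (auto simp: \<delta>_def algebra_simps)
  have 3: "\<delta> N * \<delta> N * T N N = T N N"
    using s by (simp add: \<delta>_def)
  have "(\<Sum>i<Suc N. \<Sum>j<Suc N. \<delta> i * \<delta> j * T i j)
      = (\<Sum>i<N. \<Sum>j<N. \<delta> i * \<delta> j * T i j)
        + ((\<Sum>j<N. \<delta> N * \<delta> j * T N j) + (\<Sum>i<N. \<delta> i * \<delta> N * T i N))
        + \<delta> N * \<delta> N * T N N"
    by (simp add: sum.distrib)
  also have "\<dots> = (\<Sum>i<N. \<Sum>j<N. \<epsilon> i * \<epsilon> j * T i j) + s * r + T N N"
    unfolding 1 2 3 ..
  finally have "(\<Sum>i<Suc N. \<Sum>j<Suc N. \<delta> i * \<delta> j * T i j)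
      = (\<Sum>i<N. \<Sum>j<N. \<epsilon> i * \<epsilon> j * T i j) + s * r + T N N" .
  with le s have "(\<Sum>i<Suc N. T i i) \<le> (\<Sum>i<Suc N. \<Sum>j<Suc N. \<delta> i * \<delta> j * T i j)"
    by simp
  moreover have "\<forall>i. \<bar>\<delta> i\<bar> = 1"
    using e s by (simp add: \<delta>_def)
  ultimately show ?case by blast
qed

section \<open>Convexity of powers and Hoelder's inequality for finite sums\<close>

text \<open>For two positive points this is \<open>powr_convex\<close>. If one point is 0, it
  reduces to \<open>(s * z) powr p \<le> s * z powr p\<close> for 0 < s < 1, which holds because
  \<open>s powr p \<le> s\<close>.\<close>

lemma convex_on_powr_nonneg:
  fixes p :: real
  assumes p: "p \<ge> 1"
  shows "convex_on {0..} (\<lambda>x. x powr p)"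
proof (rule convex_onI)
  fix t x y :: real
  assume t: "0 < t" "t < 1" and xy: "x \<in> {0..}" "y \<in> {0..}"
  have sub: "(s * z) powr p \<le> s * z powr p" if "0 < s" "s < 1" "0 \<le> z" for s z :: real
  proof -
    have "s powr p \<le> s powr 1" using that p by (intro powr_mono') auto
    with that show ?thesis by (simp add: powr_mult mult_right_mono)
  qed
  show "((1 - t) *\<^sub>R x + t *\<^sub>R y) powr p \<le> (1 - t) * x powr p + t * y powr p"
  proof (cases "x = 0 \<or> y = 0")
    case True
    then show ?thesis using sub[of t y] sub[of "1 - t" x] t xy p by auto
  next
    case False
    then show ?thesis
      using convex_onD[OF powr_convex[OF p], of t x y] t xy by simp
  qed
qed simp

text \<open>Hoelder's inequality against the constant 1, obtained from Jensen's inequality for the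
  power 1/b with equal weights 1/n.\<close>

lemma sum_le_card_powr_mult_powr_sum:
  fixes f :: "'i \<Rightarrow> real"
  assumes I: "finite I" and f: "\<And>i. i \<in> I \<Longrightarrow> f i \<ge> 0" and b: "0 < b" "b \<le> 1"
  shows "(\<Sum>i\<in>I. f i) \<le> card I powr (1 - b) * (\<Sum>i\<in>I. f i powr (1 / b)) powr b"
proof (cases "I = {}")
  case False
  define n where "n = real (card I)"
  have n: "n > 0" using I False by (simp add: n_def card_gt_0_iff)
  have "(\<Sum>i\<in>I. (1 / n) *\<^sub>R f i) powr (1 / b) \<le> (\<Sum>i\<in>I. (1 / n) * f i powr (1 / b))"
    using I False f b n
    by (intro convex_on_sum[where C = "{0..}"] convex_on_powr_nonneg) (auto simp: n_def)
  then have "((\<Sum>i\<in>I. f i) / n) powr (1 / b) \<le> (\<Sum>i\<in>I. f i powr (1 / b)) / n"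
    by (simp add: sum_divide_distrib)
  then have "(((\<Sum>i\<in>I. f i) / n) powr (1 / b)) powr b \<le> ((\<Sum>i\<in>I. f i powr (1 / b)) / n) powr b"
    using b by (intro powr_mono2) auto
  then have "(\<Sum>i\<in>I. f i) / n \<le> (\<Sum>i\<in>I. f i powr (1 / b)) powr b / n powr b"
    using b n f by (simp add: powr_powr powr_divide sum_nonneg)
  then have "(\<Sum>i\<in>I. f i) \<le> n / n powr b * (\<Sum>i\<in>I. f i powr (1 / b)) powr b"
    using n by (simp add: field_simps)
  also have "n / n powr b = n powr (1 - b)"
    using n by (simp add: powr_diff)
  finally show ?thesis by (simp add: n_def)
qed simp

section \<open>Membership and norms in the scale of sequence spaces\<close>

text \<open>For b > 0 the entries tend to 0, so eventually they have modulus at most 1. From there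
  on, passing to the larger exponent 1/a only decreases the powers; for a = 0 boundedness is all
  that is asked.\<close>

lemma scale_space_mono:
  assumes "0 \<le> a" "a \<le> b"
  shows "scale_space b \<subseteq> scale_space a"
proof
  fix x assume x: "x \<in> scale_space b"
  show "x \<in> scale_space a"
  proof (cases "a = b")
    case False
    with assms have b: "b > 0" by simp
    have sm: "summable (\<lambda>k. norm (x k) powr (1 / b))"
      using x b by (simp add: scale_space_pos)
    then have "eventually (\<lambda>k. norm (x k) powr (1 / b) < 1) sequentially"
      by (intro order_tendstoD[OF summable_LIMSEQ_zero]) auto
    then have ev: "eventually (\<lambda>k. norm (x k) \<le> 1) sequentially"
    proof eventually_elim
      case (elim k)
      show ?case
      proof (rule ccontr)
        assume "\<not> ?case"
        then have "norm (x k) powr (1 / b) \<ge> 1"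
          using b by (intro ge_one_powr_ge_zero) auto
        with elim show False by simp
      qed
    qed
    show ?thesis
    proof (cases "a = 0")
      case True
      have "Bseq x"
        using ev unfolding Bfun_def by (auto intro!: exI[of _ 1])
      then show ?thesis
        using True by (simp add: scale_space_0 Bseq_eq_bounded)
    next
      case a: False
      have "summable (\<lambda>k. norm (x k) powr (1 / a))"
      proof (rule summable_comparison_test_ev[OF _ sm])
        show "eventually (\<lambda>k. norm (norm (x k) powr (1 / a)) \<le> norm (x k) powr (1 / b)) sequentially"
          using ev
        proof eventually_elim
          case (elim k)
          have "1 / b \<le> 1 / a" using a assms by (intro divide_left_mono) auto
          with elim show ?case by (auto intro: powr_mono')
        qed
      qed
      with a assms show ?thesis by (simp add: scale_space_pos)
    qed
  qed (use x in simp)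
qed

lemma norm_le_scale_norm:
  assumes "0 \<le> a" "x \<in> scale_space a"
  shows "norm (x k) \<le> scale_norm a x"
proof (cases "a = 0")
  case True
  with assms have "bdd_above (range (\<lambda>k. norm (x k)))"
    by (auto simp: scale_space_0 bounded_iff bdd_above_def)
  then show ?thesis using True by (auto simp: scale_norm_0 intro: cSUP_upper)
next
  case False
  with assms have a: "a > 0" and sm: "summable (\<lambda>k. norm (x k) powr (1 / a))"
    by (auto simp: scale_space_pos)
  have "norm (x k) = (norm (x k) powr (1 / a)) powr a"
    using a by (simp add: powr_powr)
  also have "\<dots> \<le> (\<Sum>k. norm (x k) powr (1 / a)) powr a"
    using a sum_le_suminf[OF sm, of "{k}"] by (intro powr_mono2) auto
  finally show ?thesis using a by (simp add: scale_norm_pos)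
qed

text \<open>Stands in for closure under sums: finitely supported sequences are finite changes of
  zero, and the difference of a unit vector and its image is a finite change, up to modulus, of the
  image.\<close>

lemma scale_space_finite_change:
  assumes "0 \<le> a" "x \<in> scale_space a" "finite {k. norm (y k) \<noteq> norm (x k)}"
  shows "y \<in> scale_space a"
proof -
  have ev: "eventually (\<lambda>k. norm (y k) = norm (x k)) sequentially"
    using assms(3) by (simp add: cofinite_eq_sequentially[symmetric] eventually_cofinite)
  show ?thesis
  proof (cases "a = 0")
    case True
    with assms obtain M where M: "\<And>k. norm (x k) \<le> M"
      by (auto simp: scale_space_0 bounded_iff)
    have "Bseq y"
      unfolding Bfun_def
      \<comment> \<open>\<open>Bfun\<close> asks for a strictly positive bound, hence the maximum
        with 1.\<close>
      by (intro exI[of _ "max M 1"] conjI eventually_mono[OF ev]) (auto simp: le_max_iff_disj M)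
    with True show ?thesis by (simp add: scale_space_0 Bseq_eq_bounded)
  next
    case False
    with assms have a: "a > 0" and sm: "summable (\<lambda>k. norm (x k) powr (1 / a))"
      by (auto simp: scale_space_pos)
    have "summable (\<lambda>k. norm (y k) powr (1 / a))"
      by (rule iffD2[OF summable_cong sm]) (use ev in eventually_elim, simp)
    with a show ?thesis by (simp add: scale_space_pos)
  qed
qed

lemma scale_space_finite_support:
  assumes "0 \<le> a" "finite {k. x k \<noteq> 0}"
  shows "x \<in> scale_space a"
proof (rule scale_space_finite_change[of a "\<lambda>_. 0"])
  show "(\<lambda>_. 0) \<in> scale_space a"
    using assms by (cases "a = 0") (auto simp: scale_space_0 scale_space_pos)
qed (use assms in simp_all)

lemma scale_norm_unimodular_on:
  assumes "0 \<le> a" "finite I" "I \<noteq> {}" "\<And>k. norm (x k) = indicator I k"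
  shows "scale_norm a x = card I powr a"
proof (cases "a = 0")
  case True
  have "(SUP k. norm (x k)) = 1"
  proof (rule cSup_eq_maximum)
    show "1 \<in> range (\<lambda>k. norm (x k))"
      using assms by (force simp: image_iff indicator_def)
  qed (use assms in \<open>auto simp: indicator_def\<close>)
  with True assms show ?thesis by (simp add: scale_norm_0)
next
  case False
  with assms have a: "a > 0" by simp
  have "(\<Sum>k. norm (x k) powr (1 / a)) = (\<Sum>k\<in>I. norm (x k) powr (1 / a))"
    using assms a by (intro suminf_finite) auto
  also have "\<dots> = card I" using assms by simp
  finally show ?thesis using a by (simp add: scale_norm_pos)
qed

text \<open>Linearity is only available on members of the domain, so the induction also has to place
  each partial sum there; finite support does this.\<close>

lemma linear_operator_sum:
  fixes x :: "nat \<Rightarrow> nat \<Rightarrow> complex"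
  assumes lin: "linear_operator (scale_space a) Y T" and a: "0 \<le> a"
    and fin: "\<And>j. finite {k. x j k \<noteq> 0}"
  shows "T (\<lambda>k. \<Sum>j<N. c j * x j k) = (\<lambda>k. \<Sum>j<N. c j * T (x j) k)"
proof -
  have add: "T (\<lambda>k. y k + z k) = (\<lambda>k. T y k + T z k)"
    if "y \<in> scale_space a" "z \<in> scale_space a" for y z
    using lin that by (simp add: linear_operator_def)
  have scale: "T (\<lambda>k. d * y k) = (\<lambda>k. d * T y k)" if "y \<in> scale_space a" for d y
    using lin that by (simp add: linear_operator_def)
  show ?thesis
  proof (induction N)
    case 0
    \<comment> \<open>The image of zero is zero by homogeneity with scalar 0.\<close>
    have "(\<lambda>_. 0) \<in> scale_space a" using a by (rule scale_space_finite_support) simp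
    from scale[OF this, of 0] show ?case by simp
  next
    case (Suc N)
    have x: "x N \<in> scale_space a" using a fin by (rule scale_space_finite_support)
    have cx: "(\<lambda>k. c N * x N k) \<in> scale_space a"
      using a by (rule scale_space_finite_support) (rule finite_subset[OF _ fin[of N]], auto)
    have sx: "(\<lambda>k. \<Sum>j<N. c j * x j k) \<in> scale_space a"
    proof (rule scale_space_finite_support[OF a])
      have "{k. (\<Sum>j<N. c j * x j k) \<noteq> 0} \<subseteq> (\<Union>j<N. {k. x j k \<noteq> 0})"
        by (auto elim!: sum.not_neutral_contains_not_neutral)
      then show "finite {k. (\<Sum>j<N. c j * x j k) \<noteq> 0}"
        by (rule finite_subset) (use fin in auto)
    qed
    have "T (\<lambda>k. (\<Sum>j<N. c j * x j k) + c N * x N k)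
        = (\<lambda>k. T (\<lambda>k. \<Sum>j<N. c j * x j k) k + T (\<lambda>k. c N * x N k) k)"
      using sx cx by (rule add)
    also have "T (\<lambda>k. c N * x N k) = (\<lambda>k. c N * T (x N) k)"
      using x by (rule scale)
    finally show ?case by (simp add: Suc.IH)
  qed
qed

section \<open>The contradiction for a single operator, and its use for families\<close>

lemma no_near_identity_smoothing_operator:
  assumes ab: "0 \<le> a" "a < b" "b \<le> 1"
    and lin: "linear_operator (scale_space a) (scale_space b) T"
    and bounded: "\<And>x. x \<in> scale_space a \<Longrightarrow> scale_norm b (T x) \<le> C * scale_norm a x"
    and near: "\<And>x. x \<in> scale_space b \<Longrightarrow> scale_norm a (\<lambda>k. x k - T x k) \<le> 1 / 2 * scale_norm b x"
  shows False
proof -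
  define e :: "nat \<Rightarrow> nat \<Rightarrow> complex" where "e = (\<lambda>j k. of_bool (k = j))"
  have diag: "Re (T (e j) j) \<ge> 1 / 2" for j
  proof -
    have e: "e j \<in> scale_space s" if "s \<ge> 0" for s
      using that by (rule scale_space_finite_support) (simp add: e_def)
    have "T (e j) \<in> scale_space b"
      using lin e[of a] ab unfolding linear_operator_def by blast
    \<comment> \<open>The real-valued \<open>scale_norm\<close> controls coordinates only on the
      space itself, so membership of the difference must be settled before its \<open>j\<close>-th
      entry can be estimated.\<close>
    then have "T (e j) \<in> scale_space a"
      using scale_space_mono[of a b] ab by auto
    then have "(\<lambda>k. e j k - T (e j) k) \<in> scale_space a"
    proof (rule scale_space_finite_change[OF ab(1)])
      show "finite {k. norm (e j k - T (e j) k) \<noteq> norm (T (e j) k)}"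
        by (rule finite_subset[of _ "{j}"]) (auto simp: e_def)
    qed
    then have "norm (e j j - T (e j) j) \<le> scale_norm a (\<lambda>k. e j k - T (e j) k)"
      using ab(1) norm_le_scale_norm by blast
    also have "\<dots> \<le> 1 / 2 * scale_norm b (e j)"
      using ab by (intro near e) simp
    also have "scale_norm b (e j) = 1"
      using ab by (subst scale_norm_unimodular_on[where I = "{j}"]) (auto simp: e_def)
    finally have "norm (1 - T (e j) j) \<le> 1 / 2" by (simp add: e_def)
    with complex_Re_le_cmod[of "1 - T (e j) j"] show ?thesis by simp
  qed
  have le: "real N powr (b - a) \<le> 2 * C" if N: "N > 0" for N
  proof -
    \<comment> \<open>The matrix has \<open>T (e j) i\<close> in row i and column j. Real parts
      suffice, as the signs are real and commute with \<open>Re\<close>.\<close>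
    obtain \<epsilon> :: "nat \<Rightarrow> real" where \<epsilon>: "\<And>i. \<bar>\<epsilon> i\<bar> = 1"
      and tr: "(\<Sum>i<N. Re (T (e i) i)) \<le> (\<Sum>i<N. \<Sum>j<N. \<epsilon> i * \<epsilon> j * Re (T (e j) i))"
      using ex_signs_trace_le[where N = N and T = "\<lambda>i j. Re (T (e j) i)"] by blast
    define x where "x = (\<lambda>k. \<Sum>j<N. of_real (\<epsilon> j) * e j k)"
    have Tx: "T x = (\<lambda>k. \<Sum>j<N. of_real (\<epsilon> j) * T (e j) k)"
      unfolding x_def by (rule linear_operator_sum[OF lin ab(1)]) (simp add: e_def)
    have x: "norm (x k) = indicator {..<N} k" for k
    proof -
      have "x k = (\<Sum>j<N. if k = j then of_real (\<epsilon> j) else 0)"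
        unfolding x_def by (intro sum.cong) (auto simp: e_def)
      then show ?thesis by (simp add: \<epsilon> indicator_def)
    qed
    have xa: "x \<in> scale_space a"
    proof (rule scale_space_finite_support[OF ab(1)])
      show "finite {k. x k \<noteq> 0}"
      proof (rule finite_subset)
        have "x k = 0" if "k \<notin> {..<N}" for k using x[of k] that by simp
        then show "{k. x k \<noteq> 0} \<subseteq> {..<N}" by blast
      qed simp
    qed
    have Txb: "T x \<in> scale_space b"
      using lin xa unfolding linear_operator_def by blast
    have "real N / 2 = (\<Sum>i<N. 1 / 2)" by simp
    also have "\<dots> \<le> (\<Sum>i<N. Re (T (e i) i))" by (intro sum_mono diag)
    also note tr
    also have "(\<Sum>i<N. \<Sum>j<N. \<epsilon> i * \<epsilon> j * Re (T (e j) i)) = (\<Sum>i<N. \<epsilon> i * Re (T x i))"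
      by (simp add: Tx sum_distrib_left mult.assoc)
    also have "\<dots> \<le> (\<Sum>i<N. norm (T x i))"
    proof (rule sum_mono)
      fix i
      have "\<epsilon> i * Re (T x i) \<le> \<bar>\<epsilon> i * Re (T x i)\<bar>" by simp
      also have "\<dots> \<le> norm (T x i)" by (simp add: abs_mult \<epsilon> abs_Re_le_cmod)
      finally show "\<epsilon> i * Re (T x i) \<le> norm (T x i)" .
    qed
    \<comment> \<open>Hoelder on the first N coordinates; the next step completes the finite sum to
      the full norm of \<open>T x\<close>.\<close>
    also have "\<dots> \<le> real N powr (1 - b) * (\<Sum>i<N. norm (T x i) powr (1 / b)) powr b"
      using sum_le_card_powr_mult_powr_sum[of "{..<N}" "\<lambda>i. norm (T x i)" b] ab by simp
    also have "\<dots> \<le> real N powr (1 - b) * scale_norm b (T x)"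
      using Txb ab by (auto simp: scale_norm_pos scale_space_pos
        intro!: mult_left_mono powr_mono2 sum_le_suminf sum_nonneg)
    also have "\<dots> \<le> real N powr (1 - b) * (C * real N powr a)"
      using bounded[OF xa] scale_norm_unimodular_on[OF ab(1) _ _ x] N
      by (intro mult_left_mono) (auto simp: lessThan_empty_iff)
    \<comment> \<open>Since 1 - b + a = 1 - (b - a), the chain reads N/2 \<le> C N / N^(b-a), and
      cancelling N gives the claim.\<close>
    also have "\<dots> = C * (real N / real N powr (b - a))"
      using N by (simp add: powr_diff field_simps)
    finally show ?thesis using N by (simp add: field_simps)
  qed
  have "filterlim (\<lambda>N::nat. real N powr (b - a)) at_top sequentially"
    using ab by real_asymp
  then have "eventually (\<lambda>N::nat. real N powr (b - a) > 2 * C \<and> N > 0) sequentially"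
    by (intro eventually_conj eventually_gt_at_top) (simp add: filterlim_at_top_dense)
  then obtain N :: nat where "real N powr (b - a) > 2 * C" "N > 0"
    unfolding eventually_sequentially by blast
  with le[of N] show False by simp
qed

lemma no_smoothing_family:
  assumes ab: "0 \<le> a" "a < b" "b \<le> 1"
    and lin: "\<And>\<theta>. \<theta> \<ge> 1 \<Longrightarrow> linear_operator (scale_space a) (scale_space b) (S \<theta>)"
    and bounded: "\<And>\<theta> x. \<theta> \<ge> 1 \<Longrightarrow> x \<in> scale_space a \<Longrightarrow>
      scale_norm b (S \<theta> x) \<le> A * \<theta> powr (b - a) * scale_norm a x"
    and approx: "\<And>\<theta> x. \<theta> \<ge> 1 \<Longrightarrow> x \<in> scale_space b \<Longrightarrow>
      scale_norm a (\<lambda>k. x k - S \<theta> x k) \<le> B * \<theta> powr (-(b - a)) * scale_norm b x"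
  shows False
proof -
  \<comment> \<open>The limit is 0 whatever the sign of \<open>B\<close>, so a large \<theta> brings
    the factor below 1/2. With \<theta> fixed, \<open>A * \<theta> powr (b - a)\<close> becomes the
    constant \<open>C\<close> of the single-operator lemma.\<close>
  have "((\<lambda>\<theta>. B * \<theta> powr (-(b - a))) \<longlongrightarrow> 0) at_top"
    using ab by real_asymp
  then have "eventually (\<lambda>\<theta>. B * \<theta> powr (-(b - a)) < 1 / 2 \<and> \<theta> \<ge> 1) at_top"
    by (intro eventually_conj eventually_ge_at_top order_tendstoD) auto
  then obtain \<theta> where \<theta>: "B * \<theta> powr (-(b - a)) \<le> 1 / 2" "\<theta> \<ge> 1"
    unfolding eventually_at_top_linorder by (meson less_imp_le order_refl)
  have "scale_norm a (\<lambda>k. x k - S \<theta> x k) \<le> 1 / 2 * scale_norm b x" if x: "x \<in> scale_space b" for x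
  proof -
    \<comment> \<open>Nonnegativity is read off from the bound on the entry with index 0.\<close>
    have "0 \<le> scale_norm b x"
      using order_trans[OF norm_ge_zero norm_le_scale_norm[of b x 0]] x ab by simp
    with \<theta>(1) have "B * \<theta> powr (-(b - a)) * scale_norm b x \<le> 1 / 2 * scale_norm b x"
      by (rule mult_right_mono)
    with approx[OF \<theta>(2) x] show ?thesis by simp
  qed
  from no_near_identity_smoothing_operator[OF ab lin[OF \<theta>(2)] bounded[OF \<theta>(2)] this]
  show False .
qed

theorem theorem5p14:
  shows
    "(\<not> (\<exists>(S :: real \<Rightarrow> (nat \<Rightarrow> complex) \<Rightarrow> (nat \<Rightarrow> complex))
          (A :: real \<Rightarrow> real \<Rightarrow> real) (B :: real \<Rightarrow> real \<Rightarrow> real).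
        (\<forall>\<theta>\<ge>1. linear_operator (scale_space 0) scale_space_inf (S \<theta>)) \<and>
        (\<exists>M. \<forall>a b. 0 \<le> a \<and> a \<le> b \<and> b \<le> 1 \<longrightarrow> \<bar>A a b\<bar> \<le> M \<and> \<bar>B a b\<bar> \<le> M) \<and>
        (\<forall>\<theta>\<ge>1. \<forall>a b. 0 \<le> a \<and> a \<le> b \<and> b \<le> 1 \<longrightarrow>
           (\<forall>u\<in>scale_space a.
              scale_norm b (S \<theta> u) \<le> A a b * \<theta> powr (b - a) * scale_norm a u) \<and>
           (\<forall>u\<in>scale_space b.
              scale_norm a (\<lambda>k. u k - S \<theta> u k) \<le> B a b * \<theta> powr (-(b - a)) * scale_norm b u))))
     \<and>
     (\<forall>(a::real) (b::real) (p::ereal) (q::ereal)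
        (S :: real \<Rightarrow> (nat \<Rightarrow> complex) \<Rightarrow> (nat \<Rightarrow> complex)) (A::real).
        0 \<le> a \<and> a < b \<and> b \<le> 1 \<and> p = 1 / ereal a \<and> q = 1 / ereal b \<and>
        (\<forall>\<theta>\<ge>1. linear_operator (lp_space p) (lp_space q) (S \<theta>)) \<and>
        A > 0 \<and>
        (\<forall>x\<in>lp_space p. \<forall>\<theta>\<ge>1. lp_norm q (S \<theta> x) \<le> A * \<theta> powr (b - a) * lp_norm p x) \<longrightarrow>
        \<not> (\<exists>B>0. \<forall>x\<in>lp_space q. \<forall>\<theta>\<ge>1.
              lp_norm p (\<lambda>k. x k - S \<theta> x k) \<le> B * \<theta> powr (-(b - a)) * lp_norm q x))"
proof (intro conjI notI allI impI; (elim exE conjE)?)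
  fix S :: "real \<Rightarrow> (nat \<Rightarrow> complex) \<Rightarrow> (nat \<Rightarrow> complex)" and A B :: "real \<Rightarrow> real \<Rightarrow> real"
  assume lin: "\<forall>\<theta>\<ge>1. linear_operator (scale_space 0) scale_space_inf (S \<theta>)"
    and bounds: "\<forall>\<theta>\<ge>1. \<forall>a b. 0 \<le> a \<and> a \<le> b \<and> b \<le> 1 \<longrightarrow>
           (\<forall>u\<in>scale_space a.
              scale_norm b (S \<theta> u) \<le> A a b * \<theta> powr (b - a) * scale_norm a u) \<and>
           (\<forall>u\<in>scale_space b.
              scale_norm a (\<lambda>k. u k - S \<theta> u k) \<le> B a b * \<theta> powr (-(b - a)) * scale_norm b u)"
  \<comment> \<open>The endpoint pair (0, 1) alone is contradictory: operators into the intersection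
    also map into \<open>scale_space 1\<close>.\<close>
  have "scale_space_inf \<subseteq> scale_space 1"
    by (auto simp: scale_space_inf_def)
  with lin have "linear_operator (scale_space 0) (scale_space 1) (S \<theta>)" if "\<theta> \<ge> 1" for \<theta>
    using that unfolding linear_operator_def by blast
  then show False
    by (rule no_smoothing_family[of 0 1 S "A 0 1" "B 0 1", rotated 3])
      (use bounds[rule_format, of _ 0 1] in auto)
next
  fix a b A B :: real and p q :: ereal and S :: "real \<Rightarrow> (nat \<Rightarrow> complex) \<Rightarrow> (nat \<Rightarrow> complex)"
  assume "0 \<le> a" "a < b" "b \<le> 1"
    and "p = 1 / ereal a" "q = 1 / ereal b"
    and "\<forall>\<theta>\<ge>1. linear_operator (lp_space p) (lp_space q) (S \<theta>)"
    and "\<forall>x\<in>lp_space p. \<forall>\<theta>\<ge>1. lp_norm q (S \<theta> x) \<le> A * \<theta> powr (b - a) * lp_norm p x"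
    and "\<forall>x\<in>lp_space q. \<forall>\<theta>\<ge>1.
           lp_norm p (\<lambda>k. x k - S \<theta> x k) \<le> B * \<theta> powr (-(b - a)) * lp_norm q x"
  then show False
    by (intro no_smoothing_family[of a b S A B]) (auto simp: scale_space_def scale_norm_def)
qed

end
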